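(* For every $n\ge0$, the map $F_B$ is a bijection from $\mathrm{PW}_n$ onto the set of blue-packed forests of size $n$, and $T_B$ is a bijection from the set of irreducible packed words of length $n$ onto the set of blue-packed trees of size $n$. Their inverses are the maps $F_B^*$, $T_B^*$ defined recursively by $F_B^*([])=\varepsilon$, $F_B^*([t_1,\dots,t_k])=T_B^*(t_k)\odot T_B^*(t_{k-1})\odot\cdots\odot T_B^*(t_1)$, and $T_B^*(\mathrm{Node}(i^\alpha,f_\ell,f_r))=F_B^*(f_\ell)\triangleleft_B\psi_{i^\alpha}(F_B^*(f_r))$.
   Context: Words over positive integers; $|w|$ length, $\max(w)$ largest letter ($\max(\varepsilon)=0$), $w^{[k]}$ adds $k$ to all letters. Packed: every integer $1..\max(w)$ occurs; $\mathrm{PW}_n$ packed words of length $n$; $\mathrm{pack}(w)$ replaces the $j$-th smallest distinct letter by $j$. $u\odot v=u^{[\max(v)]}\cdot v$ (associative). A global descent of $w\in\mathrm{PW}_n$ is $c$, $1\le c\le n-1$, with every letter among $w_1..w_c$ strictly greater than every letter among $w_{c+1}..w_n$; $w$ is irreducible if nonempty without global descent. Every packed $w$ decomposes uniquely as $w=w_1\odot\cdots\odot w_k$ with irreducible $w_j$. For packed $w$: $\psi_{i^\circ}(w)$ ($1\le i\le\max(w)+1$) adds $1$ to every letter $\ge i$ and appends $i$; $\psi_{i^\bullet}(w)=w\cdot i$ ($1\le i\le\max(w)$). Each nonempty packed $v$ is uniquely $\psi_{i^\alpha}(v')$ ($v'$ packed, $\alpha\in\{\circ,\bullet\}$). For packed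 $u$ and nonempty packed $v=\psi_{i^\alpha}(v')$, $u\triangleleft_B v=\psi_{(i+\max(u))^\alpha}(v'\odot u)$. The blue-factorization of irreducible $w$ is the (unique) pair $(u,v)$, $v\ne\varepsilon$, with $w=u\triangleleft_B v$ and $|u|$ maximal. Biplane trees: $\mathrm{Node}(x,f_\ell,f_r)$ with root label $x$ and ordered possibly empty lists $f_\ell,f_r$ of trees; forests are ordered lists. Blue-packed trees are labeled $i^\alpha$ ($i\ge1$, $\alpha\in\{\circ,\bullet\}$); $\omega$ = number of nodes with $\alpha=\circ$; size = number of nodes. $\mathrm{Node}(i^\alpha,[\ell_1..\ell_g],[r_1..r_d])$ is blue-packed if all children are blue-packed and either ($d=0$, $i^\alpha=1^\circ$) or ($d=1$, $i^\alpha\ne1^\circ$, $1\le i\le\omega(r_1)$); blue-packed forest = list of blue-packed trees. $F_B,T_B$ by mutual recursion: $F_B(\varepsilon)=[]$; for $w=w_1\odot\cdots\odot w_k$ (irreducible decomposition), $F_B(w)=[T_B(w_k),T_B(w_{k-1}),\dots,T_B(w_1)]$; for irreducible $w$ with blue-factorization $(u,\psi_{i^\alpha}(v'))$, $T_B(w)=\mathrm{Node}(i^\alpha,F_B(u),F_B(v'))$. *)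

theory Defs
  imports Main
begin

section \<open>Packed words\<close>

type_synonym word = "nat list"

definition wmax :: "word \<Rightarrow> nat" where
  "wmax w = (if w = [] then 0 else Max (set w))"

definition packed :: "word \<Rightarrow> bool" where
  "packed w \<longleftrightarrow> set w = {1..wmax w}"

definition PW :: "nat \<Rightarrow> word set" where
  "PW n = {w. packed w \<and> length w = n}"

definition shift :: "nat \<Rightarrow> word \<Rightarrow> word" where
  "shift k w = map (\<lambda>x. x + k) w"

definition odot :: "word \<Rightarrow> word \<Rightarrow> word"  (infixr "\<odot>" 65) where
  "u \<odot> v = shift (wmax v) u @ v"

definition odots :: "word list \<Rightarrow> word" where
  "odots ws = foldr (\<odot>) ws []"

definition global_descent :: "word \<Rightarrow> nat \<Rightarrow> bool" where
  "global_descent w c \<longleftrightarrow> 1 \<le> c \<and> c < length w \<and>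
     (\<forall>a \<in> set (take c w). \<forall>b \<in> set (drop c w). a > b)"

definition irred :: "word \<Rightarrow> bool" where
  "irred w \<longleftrightarrow> packed w \<and> w \<noteq> [] \<and> (\<nexists>c. global_descent w c)"

definition is_irred_decomp :: "word \<Rightarrow> word list \<Rightarrow> bool" where
  "is_irred_decomp w ws \<longleftrightarrow> (\<forall>x \<in> set ws. irred x) \<and> w = odots ws"

definition irred_decomp :: "word \<Rightarrow> word list" where
  "irred_decomp w = (THE ws. is_irred_decomp w ws)"

datatype mark = Circ | Bul

type_synonym label = "nat \<times> mark"

fun psi :: "label \<Rightarrow> word \<Rightarrow> word" where
  "psi (i, Circ) w = map (\<lambda>x. if x \<ge> i then x + 1 else x) w @ [i]"
| "psi (i, Bul) w = w @ [i]"

text \<open>The labels \<open>x\<close> for which \<open>psi x w\<close> is meant to be formed, for packed \<open>w\<close>.\<close>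

fun psi_ok :: "label \<Rightarrow> word \<Rightarrow> bool" where
  "psi_ok (i, Circ) w \<longleftrightarrow> 1 \<le> i \<and> i \<le> wmax w + 1"
| "psi_ok (i, Bul) w \<longleftrightarrow> 1 \<le> i \<and> i \<le> wmax w"

definition is_psi_decomp :: "word \<Rightarrow> label \<Rightarrow> word \<Rightarrow> bool" where
  "is_psi_decomp v x v' \<longleftrightarrow> packed v' \<and> psi_ok x v' \<and> v = psi x v'"

definition psi_decomp :: "word \<Rightarrow> label \<times> word" where
  "psi_decomp v = (THE (x, v'). is_psi_decomp v x v')"

definition blue_prod :: "word \<Rightarrow> word \<Rightarrow> word"  (infixl "\<lhd>\<^sub>B" 65) where
  "u \<lhd>\<^sub>B v = (case psi_decomp v of ((i, a), v') \<Rightarrow> psi (i + wmax u, a) (v' \<odot> u))"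

definition is_blue_pair :: "word \<Rightarrow> word \<Rightarrow> word \<Rightarrow> bool" where
  "is_blue_pair w u v \<longleftrightarrow> packed u \<and> packed v \<and> v \<noteq> [] \<and> w = u \<lhd>\<^sub>B v"

definition is_blue_fact :: "word \<Rightarrow> word \<Rightarrow> word \<Rightarrow> bool" where
  "is_blue_fact w u v \<longleftrightarrow> is_blue_pair w u v \<and>
     (\<forall>u' v'. is_blue_pair w u' v' \<longrightarrow> length u' \<le> length u)"

definition blue_fact :: "word \<Rightarrow> word \<times> word" where
  "blue_fact w = (THE (u, v). is_blue_fact w u v)"


section \<open>Blue-packed trees and forests\<close>

datatype 'a biplane = Node 'a "'a biplane list" "'a biplane list"

type_synonym 'a biforest = "'a biplane list"

fun tsize :: "'a biplane \<Rightarrow> nat" where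
  "tsize (Node x fl fr) = 1 + sum_list (map tsize fl) + sum_list (map tsize fr)"

definition fsize :: "'a biforest \<Rightarrow> nat" where
  "fsize f = sum_list (map tsize f)"

fun omega :: "label biplane \<Rightarrow> nat" where
  "omega (Node (i, a) fl fr) =
     (if a = Circ then 1 else 0) + sum_list (map omega fl) + sum_list (map omega fr)"

fun blue_packed :: "label biplane \<Rightarrow> bool" where
  "blue_packed (Node (i, a) fl fr) \<longleftrightarrow>
     (\<forall>t \<in> set fl. blue_packed t) \<and> (\<forall>t \<in> set fr. blue_packed t) \<and>
     (fr = [] \<and> (i, a) = (1, Circ) \<or>
      (\<exists>r. fr = [r] \<and> (i, a) \<noteq> (1, Circ) \<and> 1 \<le> i \<and> i \<le> omega r))"

definition blue_trees :: "nat \<Rightarrow> label biplane set" where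
  "blue_trees n = {t. blue_packed t \<and> tsize t = n}"

definition blue_forests :: "nat \<Rightarrow> label biforest set" where
  "blue_forests n = {f. (\<forall>t \<in> set f. blue_packed t) \<and> fsize f = n}"


section \<open>Existence and uniqueness of the decompositions\<close>

lemma wmax_Nil [simp]: "wmax [] = 0"
  by (simp add: wmax_def)

lemma wmax_ge: "x \<in> set w \<Longrightarrow> x \<le> wmax w"
  by (auto simp: wmax_def)

lemma wmax_in: "w \<noteq> [] \<Longrightarrow> wmax w \<in> set w"
  by (simp add: wmax_def)

lemma wmax_eqI: "w \<noteq> [] \<Longrightarrow> (\<And>x. x \<in> set w \<Longrightarrow> x \<le> m) \<Longrightarrow> m \<in> set w \<Longrightarrow> wmax w = m"
  by (rule antisym) (simp_all add: wmax_in wmax_ge)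

lemma packed_wmax: "set w = {1..m} \<Longrightarrow> wmax w = m"
proof (cases "w = []")
  case False
  assume s: "set w = {1..m}"
  with False have "m \<in> set w" by (metis atLeastAtMost_iff atLeastatMost_empty_iff set_empty order_refl)
  with False s show ?thesis by (intro wmax_eqI) auto
qed auto

lemma packedI: "set w = {1..m} \<Longrightarrow> packed w"
  using packed_wmax[of w m] by (simp add: packed_def)

lemma packed_pos: "packed w \<Longrightarrow> x \<in> set w \<Longrightarrow> 1 \<le> x"
  by (auto simp: packed_def)

lemma packed_Nil [simp]: "packed []"
  by (auto simp: packed_def)

lemma shift_0 [simp]: "shift 0 w = w"
  by (simp add: shift_def)

lemma odot_Nil [simp]: "u \<odot> [] = u" "[] \<odot> u = u"
  by (simp_all add: odot_def) (simp add: shift_def)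

lemma length_odot [simp]: "length (u \<odot> v) = length u + length v"
  by (simp add: odot_def shift_def)

lemma set_odot: "packed u \<Longrightarrow> packed v \<Longrightarrow> set (u \<odot> v) = {1..wmax u + wmax v}"
proof -
  assume "packed u" "packed v"
  then have u: "set u = {1..wmax u}" and v: "set v = {1..wmax v}"
    by (auto simp: packed_def)
  have "set (u \<odot> v) = (\<lambda>x. x + wmax v) ` {1..wmax u} \<union> {1..wmax v}"
    using u v by (simp add: odot_def shift_def)
  also have "\<dots> = {1..wmax u + wmax v}"
    by (auto simp: image_add_atLeastAtMost')
  finally show ?thesis .
qed

lemma packed_odot: "packed u \<Longrightarrow> packed v \<Longrightarrow> packed (u \<odot> v)"
  by (rule packedI[OF set_odot])

lemma wmax_odot: "packed u \<Longrightarrow> packed v \<Longrightarrow> wmax (u \<odot> v) = wmax u + wmax v"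
  by (rule packed_wmax[OF set_odot])

lemma odot_inj:
  assumes "u \<odot> v = u' \<odot> v'" "length v = length v'"
  shows "u = u'" "v = v'"
proof -
  show v: "v = v'" using assms by (simp add: odot_def)
  then have "shift (wmax v) u = shift (wmax v) u'" using assms by (simp add: odot_def)
  then show "u = u'" by (simp add: shift_def inj_map_eq_map inj_def)
qed

lemma odots_simps [simp]: "odots [] = []" "odots (x # xs) = x \<odot> odots xs"
  by (simp_all add: odots_def)

lemma length_odots: "x \<in> set ws \<Longrightarrow> length x \<le> length (odots ws)"
  by (induction ws) auto

lemma odot_assoc:
  assumes "packed v" "packed w"
  shows "(u \<odot> v) \<odot> w = u \<odot> (v \<odot> w)"
proof -
  have "wmax (v \<odot> w) = wmax v + wmax w" using assms by (rule wmax_odot)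
  then show ?thesis by (simp add: odot_def[of u] odot_def[of _ w] shift_def add.assoc)
qed

lemma packed_odots: "(\<forall>x \<in> set xs. packed x) \<Longrightarrow> packed (odots xs)"
  by (induction xs) (simp_all add: packed_odot)

lemma odots_append_packed:
  "(\<forall>x \<in> set xs. packed x) \<Longrightarrow> packed (odots ys) \<Longrightarrow> odots (xs @ ys) = odots xs \<odot> odots ys"
  by (induction xs) (simp_all add: odot_assoc packed_odots)

lemma irred_first_le:
  assumes "irred y" "irred x" "x \<odot> r = y \<odot> s"
  shows "length y \<le> length x"
proof (rule ccontr)
  assume "\<not> ?thesis"
  then have l: "length x < length y" by simp
  have px: "packed x" "x \<noteq> []" using assms by (auto simp: irred_def)
  have t: "take (length x) (x \<odot> r) = shift (wmax r) x" "drop (length x) (x \<odot> r) = r"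
    by (simp_all add: odot_def shift_def)
  have t': "take (length x) (y \<odot> s) = shift (wmax s) (take (length x) y)"
    "drop (length x) (y \<odot> s) = shift (wmax s) (drop (length x) y) @ s"
    using l by (simp_all add: odot_def shift_def take_map drop_map)
  have "a > b" if "a \<in> set (take (length x) y)" "b \<in> set (drop (length x) y)" for a b
  proof -
    have "a + wmax s \<in> set (shift (wmax r) x)"
      unfolding t(1)[symmetric] assms(3) t'(1) using that(1) by (simp add: shift_def)
    then have 1: "a + wmax s > wmax r" using packed_pos[OF px(1)]
      by (force simp: shift_def)
    have "b + wmax s \<in> set (drop (length x) (y \<odot> s))"
      unfolding t'(2) using that(2) by (simp add: shift_def)
    then have "b + wmax s \<in> set r"
      unfolding assms(3)[symmetric] t(2) .
    then have "b + wmax s \<le> wmax r" by (rule wmax_ge)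
    then show ?thesis using 1 by linarith
  qed
  moreover have "1 \<le> length x" using px by (cases x) auto
  ultimately have "global_descent y (length x)"
    using l by (auto simp: global_descent_def)
  then show False using assms(1) by (auto simp: irred_def)
qed

lemma irred_decomp_unique:
  "is_irred_decomp w xs \<Longrightarrow> is_irred_decomp w ys \<Longrightarrow> xs = ys"
proof (induction xs arbitrary: w ys)
  case Nil
  then show ?case by (cases ys) (auto simp: is_irred_decomp_def irred_def odot_def shift_def)
next
  case (Cons x xs)
  then have x: "irred x" "w = x \<odot> odots xs" "is_irred_decomp (odots xs) xs"
    by (auto simp: is_irred_decomp_def)
  then have "w \<noteq> []" by (auto simp: irred_def odot_def shift_def)
  then obtain y ys' where ys: "ys = y # ys'"
    using Cons.prems(2) by (cases ys) (auto simp: is_irred_decomp_def)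
  then have y: "irred y" "w = y \<odot> odots ys'" "is_irred_decomp (odots ys') ys'"
    using Cons.prems(2) by (auto simp: is_irred_decomp_def)
  have eq: "x \<odot> odots xs = y \<odot> odots ys'" using x y by simp
  then have "length x = length y" using irred_first_le x(1) y(1) by (metis le_antisym)
  then have "length (odots xs) = length (odots ys')"
    using arg_cong[OF eq, of length] by simp
  then have "x = y" "odots xs = odots ys'" using odot_inj[OF eq] by auto
  then show ?case using Cons.IH[OF x(3)] y(3) ys by auto
qed

lemma global_descent_split:
  assumes "packed w" "global_descent w c"
  obtains u v where "packed u" "packed v" "w = u \<odot> v" "length u < length w" "length v < length w"
proof -
  define A v u where "A = take c w" and "v = drop c w" and "u = map (\<lambda>x. x - wmax v) A"
  have c: "1 \<le> c" "c < length w" and d: "\<And>a b. a \<in> set A \<Longrightarrow> b \<in> set v \<Longrightarrow> a > b"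
    using assms(2) by (auto simp: global_descent_def A_def v_def)
  have w: "w = A @ v" by (simp add: A_def v_def)
  have vne: "v \<noteq> []" using c by (simp add: v_def)
  have s: "set A \<union> set v = {1..wmax w}" using assms(1) w by (auto simp: packed_def)
  have m: "wmax v \<in> set v" using vne wmax_in by auto
  have A: "set A = {wmax v + 1..wmax w}"
  proof (intro set_eqI iffI)
    fix x assume "x \<in> set A"
    then show "x \<in> {wmax v + 1..wmax w}" using d m s by fastforce
  next
    fix x assume x: "x \<in> {wmax v + 1..wmax w}"
    then have "x \<in> set A \<union> set v" using s by auto
    moreover have "x \<notin> set v" using x wmax_ge[of x v] by auto
    ultimately show "x \<in> set A" by simp
  qed
  have V: "set v = {1..wmax v}"
  proof (intro set_eqI iffI)
    fix x assume "x \<in> set v"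
    then show "x \<in> {1..wmax v}" using s wmax_ge by auto
  next
    fix x assume x: "x \<in> {1..wmax v}"
    moreover have "wmax v \<le> wmax w" using m s by auto
    ultimately have "x \<in> set A \<union> set v" using s by auto
    then show "x \<in> set v" using x A by auto
  qed
  have eq: "w = u \<odot> v" using A w
    by (auto simp: odot_def shift_def u_def intro!: map_idI[symmetric])
  have "set u = (\<lambda>x. x - wmax v) ` {wmax v + 1..wmax w}" using A by (simp add: u_def)
  also have "\<dots> = {1..wmax w - wmax v}"
  proof (intro set_eqI iffI)
    fix y assume "y \<in> {1..wmax w - wmax v}"
    then show "y \<in> (\<lambda>x. x - wmax v) ` {wmax v + 1..wmax w}"
      by (intro image_eqI[of _ _ "y + wmax v"]) auto
  qed auto
  finally have "packed u" by (rule packedI)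
  moreover have "packed v" using V by (rule packedI)
  moreover have "length u < length w" "length v < length w"
    using c by (auto simp: u_def A_def v_def)
  ultimately show thesis using that eq by blast
qed

lemma irred_decomp_exists: "packed w \<Longrightarrow> \<exists>ws. is_irred_decomp w ws"
proof (induction w rule: length_induct)
  case (1 w)
  consider "w = []" | "irred w" | c where "global_descent w c"
    using 1 by (auto simp: irred_def)
  then show ?case
  proof cases
    case 1
    then show ?thesis by (intro exI[of _ "[]"]) (simp add: is_irred_decomp_def)
  next
    case 2
    then show ?thesis by (intro exI[of _ "[w]"]) (simp add: is_irred_decomp_def)
  next
    case 3
    then obtain u v where uv: "packed u" "packed v" "w = u \<odot> v"
      "length u < length w" "length v < length w"
      using global_descent_split "1.prems" by blast
    then obtain us vs where "is_irred_decomp u us" "is_irred_decomp v vs"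
      using "1.IH" by blast
    moreover from this have "odots (us @ vs) = u \<odot> v"
      using odots_append_packed[of us vs] uv by (auto simp: is_irred_decomp_def irred_def)
    ultimately have "is_irred_decomp w (us @ vs)"
      using uv(3) by (auto simp: is_irred_decomp_def)
    then show ?thesis by blast
  qed
qed

lemma irred_decomp_ex1: "packed w \<Longrightarrow> \<exists>!ws. is_irred_decomp w ws"
  using irred_decomp_exists irred_decomp_unique by blast

lemma irred_decomp: "packed w \<Longrightarrow> is_irred_decomp w (irred_decomp w)"
  unfolding irred_decomp_def by (rule theI') (rule irred_decomp_ex1)

lemma length_psi [simp]: "length (psi x w) = Suc (length w)"
  by (cases "(x, w)" rule: psi.cases) auto

lemma psi_not_Nil [simp]: "psi x w \<noteq> []"
  by (metis length_psi list.size(3) nat.distinct(1))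

lemma psi_decomp_unique:
  assumes "is_psi_decomp v x w" "is_psi_decomp v y z"
  shows "x = y \<and> w = z"
proof -
  obtain i a j b where xy: "x = (i, a)" "y = (j, b)" by (metis surj_pair)
  have last: "last (psi (i, a) w) = i" for i a w by (cases a) auto
  have ij: "i = j" using assms last xy by (metis is_psi_decomp_def)
  have mem: "i \<in> set (butlast v) \<longleftrightarrow> a = Bul" if "is_psi_decomp v (i, a) w" for i a w
    using that by (cases a) (auto simp: is_psi_decomp_def packed_def split: if_splits)
  have "a = Bul \<longleftrightarrow> b = Bul"
    using mem[OF assms(1)[unfolded xy]] mem[OF assms(2)[unfolded xy]] ij by simp
  then have ab: "a = b" by (cases a; cases b) auto
  have "inj (\<lambda>x. if x \<ge> i then x + 1 else x)" by (auto simp: inj_def split: if_splits)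
  then have "w = z" using assms xy ij ab
    by (cases a) (auto simp: is_psi_decomp_def inj_map_eq_map)
  then show ?thesis using xy ij ab by simp
qed

lemma psi_decomp_exists:
  assumes "packed v" "v \<noteq> []"
  shows "\<exists>x w. is_psi_decomp v x w"
proof -
  define i B where "i = last v" and "B = butlast v"
  have v: "v = B @ [i]" using assms(2) by (simp add: i_def B_def)
  have s: "insert i (set B) = {1..wmax v}" using assms(1) v by (auto simp: packed_def)
  then have i: "1 \<le> i" "i \<le> wmax v" by auto
  show ?thesis
  proof (cases "i \<in> set B")
    case True
    then have B: "set B = {1..wmax v}" using s by auto
    then have "is_psi_decomp v (i, Bul) B"
      unfolding is_psi_decomp_def using packedI[OF B] packed_wmax[OF B] v i by simp
    then show ?thesis by blast
  next
    case False
    define w where "w = map (\<lambda>x. if x > i then x - 1 else x) B"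
    have B: "set B = {1..wmax v} - {i}" using s False by auto
    have "set w = (\<lambda>x. if x > i then x - 1 else x) ` ({1..wmax v} - {i})"
      using B by (simp add: w_def)
    also have "\<dots> = {1..wmax v - 1}"
    proof (intro set_eqI iffI)
      fix y assume "y \<in> {1..wmax v - 1}"
      then show "y \<in> (\<lambda>x. if x > i then x - 1 else x) ` ({1..wmax v} - {i})"
        by (intro image_eqI[of _ _ "if y \<ge> i then y + 1 else y"]) auto
    next
      fix y assume "y \<in> (\<lambda>x. if x > i then x - 1 else x) ` ({1..wmax v} - {i})"
      then show "y \<in> {1..wmax v - 1}" using i by (auto split: if_splits)
    qed
    finally have W: "set w = {1..wmax v - 1}" .
    have "map (\<lambda>x. if x \<ge> i then x + 1 else x) w = B"
      unfolding w_def map_map by (rule map_idI) (simp add: B, linarith)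
    then have "is_psi_decomp v (i, Circ) w"
      unfolding is_psi_decomp_def using packedI[OF W] packed_wmax[OF W] v i by simp
    then show ?thesis by blast
  qed
qed

lemma psi_decomp_eq: "is_psi_decomp v x w \<Longrightarrow> psi_decomp v = (x, w)"
  unfolding psi_decomp_def by (rule the_equality) (auto dest: psi_decomp_unique)

lemma psi_decomp_props:
  assumes "packed v" "v \<noteq> []" "psi_decomp v = (x, w)"
  shows "is_psi_decomp v x w"
  using psi_decomp_exists[OF assms(1,2)] psi_decomp_eq assms(3) by auto

lemma blue_prod_is_psi_decomp:
  assumes "packed u" "is_psi_decomp v (i, a) v'"
  shows "is_psi_decomp (u \<lhd>\<^sub>B v) (i + wmax u, a) (v' \<odot> u)"
  using assms psi_decomp_eq[OF assms(2)]
  by (cases a) (auto simp: is_psi_decomp_def blue_prod_def packed_odot wmax_odot)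

lemma blue_pair_length: "is_blue_pair w u v \<Longrightarrow> length w = length u + length v"
proof -
  assume b: "is_blue_pair w u v"
  then have v: "packed v" "v \<noteq> []" and w: "w = u \<lhd>\<^sub>B v" by (simp_all add: is_blue_pair_def)
  obtain i a v' where d: "psi_decomp v = ((i, a), v')" by (metis surj_pair)
  then have "v = psi (i, a) v'" using psi_decomp_props[OF v] by (simp add: is_psi_decomp_def)
  then have "length v = Suc (length v')" by simp
  moreover have "length w = Suc (length v' + length u)" using w d by (simp add: blue_prod_def)
  ultimately show ?thesis by simp
qed

lemma blue_pair_unique:
  assumes "is_blue_pair w u v" "is_blue_pair w u' v'" "length u = length u'"
  shows "u = u' \<and> v = v'"
proof -
  have p: "packed u" "packed u'" "packed v" "packed v'" "v \<noteq> []" "v' \<noteq> []"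
    and w: "w = u \<lhd>\<^sub>B v" "w = u' \<lhd>\<^sub>B v'"
    using assms by (auto simp: is_blue_pair_def)
  obtain i a z where z: "is_psi_decomp v (i, a) z" using psi_decomp_exists p by (metis surj_pair)
  obtain i' a' z' where z': "is_psi_decomp v' (i', a') z'" using psi_decomp_exists p by (metis surj_pair)
  have "is_psi_decomp w (i + wmax u, a) (z \<odot> u)"
    unfolding w(1) by (rule blue_prod_is_psi_decomp[OF p(1) z])
  moreover have "is_psi_decomp w (i' + wmax u', a') (z' \<odot> u')"
    unfolding w(2) by (rule blue_prod_is_psi_decomp[OF p(2) z'])
  ultimately have e: "i + wmax u = i' + wmax u'" "a = a'" "z \<odot> u = z' \<odot> u'"
    by (auto dest: psi_decomp_unique)
  then have "z = z'" "u = u'" using odot_inj[OF e(3)] assms(3) by auto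
  then show ?thesis using e z z' by (auto simp: is_psi_decomp_def)
qed

lemma blue_pair_trivial:
  assumes "packed w" "w \<noteq> []"
  shows "is_blue_pair w [] w"
proof -
  obtain i a v' where d: "psi_decomp w = ((i, a), v')" by (metis surj_pair)
  then have "psi (i, a) v' = w" using psi_decomp_props[OF assms] by (simp add: is_psi_decomp_def)
  then have "w = [] \<lhd>\<^sub>B w" using d by (simp add: blue_prod_def)
  then show ?thesis using assms by (simp add: is_blue_pair_def)
qed

lemma blue_fact_ex1:
  assumes "packed w" "w \<noteq> []"
  shows "\<exists>!(u, v). is_blue_fact w u v"
proof -
  let ?P = "\<lambda>k. \<exists>u v. is_blue_pair w u v \<and> length u = k"
  have "?P 0" using blue_pair_trivial[OF assms] by auto
  moreover have b: "\<forall>k. ?P k \<longrightarrow> k \<le> length w" using blue_pair_length by fastforce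
  ultimately obtain m where m: "?P m" "\<And>k. ?P k \<Longrightarrow> k \<le> m"
    using GreatestI_nat[of ?P 0 "length w"] Greatest_le_nat[of ?P _ "length w"] by blast
  then obtain u v where "is_blue_pair w u v" "length u = m" by blast
  then have uv: "is_blue_fact w u v" using m(2) unfolding is_blue_fact_def by blast
  have "u' = u \<and> v' = v" if "is_blue_fact w u' v'" for u' v'
    using that uv blue_pair_unique[of w u' v' u v] by (auto simp: is_blue_fact_def intro: antisym)
  then have "p = (u, v)" if "case p of (u, v) \<Rightarrow> is_blue_fact w u v" for p
    using that by (cases p) simp
  moreover have "case (u, v) of (u, v) \<Rightarrow> is_blue_fact w u v" using uv by simp
  ultimately show ?thesis by (rule ex1I[rotated])
qed

lemma blue_fact_props:
  assumes "packed w" "w \<noteq> []" "blue_fact w = (u, v)"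
  shows "is_blue_fact w u v"
  using theI'[OF blue_fact_ex1[OF assms(1,2)]] assms(3) by (simp add: blue_fact_def)


section \<open>The maps\<close>

text \<open>The values outside the packed, respectively irreducible, words are irrelevant.\<close>

function FB :: "word \<Rightarrow> label biforest" and TB :: "word \<Rightarrow> label biplane" where
  "FB w = (if packed w then map TB (rev (irred_decomp w)) else undefined)"
| "TB w = (if irred w then
             (case blue_fact w of (u, v) \<Rightarrow>
               (case psi_decomp v of (x, v') \<Rightarrow> Node x (FB u) (FB v')))
           else undefined)"
  by pat_completeness auto
termination
proof (relation "measure (case_sum (\<lambda>w. 2 * length w + 1) (\<lambda>w. 2 * length w))", goal_cases)
  case 1
  show ?case by simp
next
  case (2 w x)
  then show ?case using irred_decomp[of w] length_odots[of x]
    by (fastforce simp: is_irred_decomp_def)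
next
  case (3 w u v x v')
  then have p: "packed w" "w \<noteq> []" "blue_fact w = (u, v)" by (auto simp: irred_def)
  have b: "is_blue_pair w u v" using blue_fact_props[OF p] by (simp add: is_blue_fact_def)
  then have "v \<noteq> []" by (simp add: is_blue_pair_def)
  then show ?case using blue_pair_length[OF b] by (cases v) auto
next
  case (4 w u v x v')
  then have p: "packed w" "w \<noteq> []" "blue_fact w = (u, v)" "psi_decomp v = (x, v')"
    by (auto simp: irred_def)
  have b: "is_blue_pair w u v" using blue_fact_props[OF p(1-3)] by (simp add: is_blue_fact_def)
  then have "packed v" "v \<noteq> []" by (simp_all add: is_blue_pair_def)
  then have "v = psi x v'" using psi_decomp_props[OF _ _ p(4)]
    by (simp add: is_psi_decomp_def)
  then have "length w = length u + Suc (length v')" using blue_pair_length[OF b] by simp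
  then show ?case by simp
qed

declare FB.simps [simp del] TB.simps [simp del]

function FB_star :: "label biforest \<Rightarrow> word" and TB_star :: "label biplane \<Rightarrow> word" where
  "FB_star f = odots (map TB_star (rev f))"
| "TB_star (Node x fl fr) = FB_star fl \<lhd>\<^sub>B psi x (FB_star fr)"
  by pat_completeness auto
termination
proof (relation "measure (case_sum (\<lambda>f. 2 * fsize f + 1) (\<lambda>t. 2 * tsize t))", goal_cases)
  case 1
  show ?case by simp
next
  case (2 f t)
  then have "tsize t \<le> fsize f" by (auto simp: fsize_def intro: member_le_sum_list)
  then show ?case by simp
qed (auto simp: fsize_def)

declare FB_star.simps [simp del]

end

theory Submission
  imports Defs
begin

text \<open>
  Let \<open>w = psi (j, a) y\<close> be irreducible. A blue pair \<open>(u, v)\<close> of \<open>w\<close> amounts to writing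
  \<open>y = v' \<odot> u\<close> with \<open>wmax u < j\<close>, so in the blue-factorization \<open>u\<close> collects as many trailing
  irreducible factors of \<open>y\<close> as this inequality allows. Hence the last irreducible factor of
  \<open>v'\<close> contains a letter at least \<open>i = j - wmax u\<close>, and any factor in front of it would produce
  a global descent of \<open>w\<close>. So \<open>v'\<close> is empty or irreducible, and the label \<open>1\<^sup>\<circ>\<close> occurs
  precisely when it is empty. Conversely, all such data produce irreducible words with the
  expected blue-factorization. As \<open>omega\<close> corresponds to \<open>wmax\<close>, these are the conditions
  defining blue-packed trees.
\<close>

section \<open>Effect of \<open>psi\<close> on letters and maxima\<close>

text \<open>The action of \<open>psi x\<close> on one letter of its argument, uniform in the mark.
  It is strictly increasing, so letters compare alike before and after.\<close>

definition bump :: "label \<Rightarrow> nat \<Rightarrow> nat" where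
  "bump x b = (if snd x = Circ \<and> fst x \<le> b then b + 1 else b)"

lemma psi_eq_map_bump: "psi x w = map (bump x) w @ [fst x]"
  by (cases "(x, w)" rule: psi.cases) (auto simp: bump_def intro!: map_idI[symmetric])

lemma bump_less_iff [simp]: "bump x b < bump x c \<longleftrightarrow> b < c"
  by (auto simp: bump_def)

text \<open>Only \<open>Circ\<close> pushes a letter equal to the appended \<open>j\<close> above
  it; this is how the mark influences global descents.\<close>

lemma less_bump_iff: "j < bump (j, a) b \<longleftrightarrow> j < b \<or> j = b \<and> a = Circ"
  by (auto simp: bump_def)

text \<open>With \<open>Circ\<close>, the letters from \<open>i\<close> on move up and leave a gap
  that the appended \<open>i\<close> fills; with \<open>Bul\<close>, \<open>i\<close> already
  occurs.\<close>

lemma wmax_psi: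
  assumes "packed w" "psi_ok x w"
  shows "wmax (psi x w) = wmax w + (if snd x = Circ then 1 else 0)"
    and "packed (psi x w)"
proof -
  obtain i a where x: "x = (i, a)" by (cases x)
  have s: "set w = {1..wmax w}" using assms(1) by (simp add: packed_def)
  have "set (psi x w) = {1..wmax w + (if snd x = Circ then 1 else 0)}"
  proof (cases a)
    case Circ
    have "insert i ((\<lambda>b. if i \<le> b then b + 1 else b) ` {1..wmax w}) = {1..wmax w + 1}"
    proof (intro set_eqI iffI)
      fix b assume b: "b \<in> {1..wmax w + 1}"
      consider "b = i" | "b < i" | "b > i" by linarith
      then show "b \<in> insert i ((\<lambda>b. if i \<le> b then b + 1 else b) ` {1..wmax w})"
      proof cases
        case 2
        then have "b \<in> (\<lambda>b. if i \<le> b then b + 1 else b) ` {1..wmax w}"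
          using b assms(2) x Circ by (intro image_eqI[of _ _ b]) auto
        then show ?thesis by simp
      next
        case 3
        then have "b \<in> (\<lambda>b. if i \<le> b then b + 1 else b) ` {1..wmax w}"
          using b assms(2) x Circ by (intro image_eqI[of _ _ "b - 1"]) auto
        then show ?thesis by simp
      qed simp
    qed (use assms(2) x Circ in auto)
    then show ?thesis using x Circ s by simp
  next
    case Bul
    then show ?thesis using x s assms(2) by auto
  qed
  then show "wmax (psi x w) = wmax w + (if snd x = Circ then 1 else 0)" "packed (psi x w)"
    by (rule packed_wmax, rule packedI)
qed

lemma blue_prod_psi:
  assumes "packed v'" "psi_ok (i, a) v'"
  shows "u \<lhd>\<^sub>B psi (i, a) v' = psi (i + wmax u, a) (v' \<odot> u)"
proof -
  have "is_psi_decomp (psi (i, a) v') (i, a) v'" using assms by (simp add: is_psi_decomp_def)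
  then show ?thesis using psi_decomp_eq by (simp add: blue_prod_def)
qed

text \<open>This is the recursion of \<open>omega\<close> at a node, so \<open>omega\<close> of a
  tree becomes the maximum of its word.\<close>

lemma wmax_blue_prod_psi:
  assumes "packed u" "packed v'" "psi_ok (i, a) v'"
  shows "wmax (u \<lhd>\<^sub>B psi (i, a) v') = wmax u + wmax v' + (if a = Circ then 1 else 0)"
proof -
  have "psi_ok (i + wmax u, a) (v' \<odot> u)"
    using assms by (cases a) (auto simp: wmax_odot)
  then show ?thesis
    using wmax_psi(1)[OF packed_odot[OF assms(2,1)]] assms by (simp add: blue_prod_psi wmax_odot)
qed

text \<open>Uniqueness of the \<open>psi\<close> decomposition identifies labels and prefixes. The
  bound \<open>wmax u < j\<close> says that the label left for \<open>v\<close> is at least 1; its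
  upper bound follows because \<open>wmax\<close> is additive.\<close>

lemma is_blue_pair_psi_iff:
  assumes "packed y" "psi_ok (j, a) y"
  shows "is_blue_pair (psi (j, a) y) u v \<longleftrightarrow>
    (\<exists>v'. packed u \<and> packed v' \<and> y = v' \<odot> u \<and> wmax u < j \<and> v = psi (j - wmax u, a) v')"
    (is "?L \<longleftrightarrow> ?R")
proof
  assume ?L
  then have p: "packed u" "packed v" "v \<noteq> []" and eq: "psi (j, a) y = u \<lhd>\<^sub>B v"
    by (auto simp: is_blue_pair_def)
  obtain i b v' where d: "is_psi_decomp v (i, b) v'"
    using psi_decomp_exists[OF p(2,3)] by (metis surj_pair)
  have "is_psi_decomp (psi (j, a) y) (i + wmax u, b) (v' \<odot> u)"
    unfolding eq by (rule blue_prod_is_psi_decomp[OF p(1) d])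
  moreover have "is_psi_decomp (psi (j, a) y) (j, a) y"
    using assms by (simp add: is_psi_decomp_def)
  ultimately have "j = i + wmax u" "a = b" "y = v' \<odot> u"
    using psi_decomp_unique by fastforce+
  moreover have "1 \<le> i" using d by (cases b) (auto simp: is_psi_decomp_def)
  ultimately show ?R using p d by (auto simp: is_psi_decomp_def)
next
  assume ?R
  then obtain v' where v': "packed u" "packed v'" "y = v' \<odot> u" "wmax u < j"
    "v = psi (j - wmax u, a) v'" by blast
  then have ok: "psi_ok (j - wmax u, a) v'"
    using assms(2) by (cases a) (auto simp: wmax_odot)
  then show ?L
    using v' wmax_psi(2)[OF v'(2) ok] by (simp add: is_blue_pair_def blue_prod_psi)
qed

section \<open>Global descents and irreducibility of the images of \<open>psi\<close>\<close>

text \<open>The letters of \<open>p\<close> are shifted above \<open>wmax q\<close> and stay above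
  those of \<open>q\<close>. They also stay above \<open>j\<close>: in the second case, any of them
  equal to \<open>j\<close> is bumped past it.\<close>

lemma global_descent_psi:
  assumes "packed p" "p \<noteq> []" "j \<le> wmax q \<or> j = wmax q + 1 \<and> a = Circ"
  shows "global_descent (psi (j, a) (p \<odot> q)) (length p)"
proof -
  have eq: "psi (j, a) (p \<odot> q) =
      map (bump (j, a)) (shift (wmax q) p) @ map (bump (j, a)) q @ [j]"
    by (simp add: psi_eq_map_bump odot_def)
  have gt: "wmax q < b" if "b \<in> set (shift (wmax q) p)" for b
    using that packed_pos[OF assms(1)] by (force simp: shift_def)
  \<comment> \<open>Admitting \<open>c = wmax q\<close> keeps the comparison with \<open>j\<close>
    available when \<open>q\<close> is empty.\<close>
  have "bump (j, a) c < bump (j, a) b \<and> j < bump (j, a) b"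
    if "b \<in> set (shift (wmax q) p)" "c \<in> set q \<or> c = wmax q" for b c
    using gt[OF that(1)] wmax_ge[of c q] that(2) assms(3) by (auto simp: less_bump_iff)
  moreover have "length (shift (wmax q) p) = length p" by (simp add: shift_def)
  ultimately show ?thesis
    using assms(2) unfolding eq global_descent_def by (cases p) auto
qed

text \<open>A cut inside \<open>y\<close> would give a descent of \<open>y\<close>, whose letters
  undergo a strictly increasing map. Any later cut separates the smallest letter of \<open>y\<close>
  from the last letter \<open>j\<close>.\<close>

lemma irred_psi_odot:
  assumes "irred y" "packed u" "j \<le> wmax y + wmax u" "wmax u + 1 \<le> j"
    "(j, a) \<noteq> (wmax u + 1, Circ)"
  shows "irred (psi (j, a) (y \<odot> u))"
proof -
  let ?f = "\<lambda>b. bump (j, a) (b + wmax u)"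
  have y: "packed y" "y \<noteq> []" using assms(1) by (auto simp: irred_def)
  have eq: "psi (j, a) (y \<odot> u) = map ?f y @ map (bump (j, a)) u @ [j]"
    by (simp add: psi_eq_map_bump odot_def shift_def)
  have "psi_ok (j, a) (y \<odot> u)"
    using assms y by (cases a) (auto simp: wmax_odot)
  then have packed: "packed (psi (j, a) (y \<odot> u))"
    by (rule wmax_psi(2)[OF packed_odot[OF y(1) assms(2)]])
  have "\<not> global_descent (psi (j, a) (y \<odot> u)) c" for c
  proof
    assume gd: "global_descent (psi (j, a) (y \<odot> u)) c"
    show False
    proof (cases "c < length y")
      case True
      have "c' < b" if "b \<in> set (take c y)" "c' \<in> set (drop c y)" for b c'
      proof -
        have "?f b \<in> set (take c (psi (j, a) (y \<odot> u)))"
          "?f c' \<in> set (drop c (psi (j, a) (y \<odot> u)))"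
          using that True by (auto simp: eq take_map drop_map)
        then have "?f c' < ?f b" using gd unfolding global_descent_def by blast
        then show ?thesis by simp
      qed
      then have "global_descent y c"
        using gd True by (auto simp: global_descent_def)
      then show False using assms(1) by (auto simp: irred_def)
    next
      case False
      have "1 \<in> set y" using y wmax_in[OF y(2)] by (auto simp: packed_def)
      then have "?f 1 \<in> set (take c (psi (j, a) (y \<odot> u)))"
        using False unfolding eq by (simp add: rev_image_eqI)
      moreover have "j \<in> set (drop c (psi (j, a) (y \<odot> u)))"
      proof -
        have "c < length (psi (j, a) (y \<odot> u))" using gd by (simp add: global_descent_def)
        then have "last (drop c (psi (j, a) (y \<odot> u))) = j" "drop c (psi (j, a) (y \<odot> u)) \<noteq> []"
          by (simp_all add: last_drop psi_eq_map_bump)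
        then show ?thesis by (metis last_in_set)
      qed
      \<comment> \<open>\<open>?f 1\<close> is the image of \<open>wmax u + 1\<close>; given the
        lower bound on \<open>j\<close>, it exceeds \<open>j\<close> only for the excluded
        label.\<close>
      ultimately have "j < ?f 1" using gd by (simp add: global_descent_def)
      then show False using assms(4,5) by (auto simp: less_bump_iff)
    qed
  qed
  then show ?thesis using packed by (simp add: irred_def)
qed

text \<open>The word for an empty right forest: no letter of \<open>u\<close> is bumped, and a
  strict maximum in last place rules out every descent.\<close>

lemma irred_psi_Circ_max:
  assumes "packed u"
  shows "irred (psi (wmax u + 1, Circ) u)"
proof -
  have "psi (wmax u + 1, Circ) u = u @ [wmax u + 1]"
    using wmax_ge by (force simp: intro!: map_idI)
  moreover have "packed (psi (wmax u + 1, Circ) u)"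
    using assms by (intro wmax_psi(2)) auto
  moreover have "\<not> global_descent (u @ [wmax u + 1]) c" for c
  proof
    assume gd: "global_descent (u @ [wmax u + 1]) c"
    then have c: "1 \<le> c" "c \<le> length u" by (auto simp: global_descent_def)
    then have "hd u \<in> set (take c u)" by (cases u; cases c) auto
    then have "wmax u + 1 < hd u" using gd c by (auto simp: global_descent_def)
    moreover have "hd u \<in> set u" using c by (cases u) auto
    ultimately show False using wmax_ge[of "hd u" u] by simp
  qed
  ultimately show ?thesis by (simp add: irred_def)
qed

section \<open>Blue-factorizations and root labels\<close>

text \<open>The condition that being blue-packed imposes on a root label, read on the word \<open>v'\<close> that
  corresponds to the right forest.\<close>

definition blue_label :: "label \<Rightarrow> word \<Rightarrow> bool" where
  "blue_label x v' \<longleftrightarrow>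
     v' = [] \<and> x = (1, Circ) \<or> irred v' \<and> x \<noteq> (1, Circ) \<and> 1 \<le> fst x \<and> fst x \<le> wmax v'"

lemma blue_label_psi_ok: "blue_label x v' \<Longrightarrow> packed v' \<and> psi_ok x v'"
  by (cases "(x, v')" rule: psi_ok.cases) (auto simp: blue_label_def irred_def)

text \<open>Maximality of \<open>u\<close> bounds the label by the maximum of the last factor
  \<open>y\<close> of \<open>v'\<close>; irreducibility of \<open>w\<close> then removes the factors
  before \<open>y\<close> and excludes the label \<open>(1, Circ)\<close>.\<close>

lemma blue_fact_label:
  assumes "irred w" "blue_fact w = (u, v)" "psi_decomp v = (x, v')"
  shows "packed u" "blue_label x v'" "w = u \<lhd>\<^sub>B psi x v'"
proof -
  have w: "packed w" "w \<noteq> []" using assms(1) by (auto simp: irred_def)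
  have bf: "is_blue_fact w u v" by (rule blue_fact_props[OF w assms(2)])
  then have v: "packed u" "packed v" "v \<noteq> []" "w = u \<lhd>\<^sub>B v"
    by (auto simp: is_blue_fact_def is_blue_pair_def)
  obtain i a where x: "x = (i, a)" by (cases x)
  have d: "is_psi_decomp v (i, a) v'" using psi_decomp_props[OF v(2,3) assms(3)] x by simp
  have dw: "is_psi_decomp w (i + wmax u, a) (v' \<odot> u)"
    unfolding v(4) by (rule blue_prod_is_psi_decomp[OF v(1) d])
  have v': "packed v'" "psi_ok (i, a) v'" "v = psi (i, a) v'"
    using d by (auto simp: is_psi_decomp_def)
  have i: "1 \<le> i" using v'(2) by (cases a) auto
  show "packed u" by (rule v(1))
  show "w = u \<lhd>\<^sub>B psi x v'" using v(4) v'(3) x by simp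
  obtain ws where ws: "\<forall>z \<in> set ws. irred z" "v' = odots ws"
    using irred_decomp_exists[OF v'(1)] by (auto simp: is_irred_decomp_def)
  show "blue_label x v'"
  proof (cases ws rule: rev_cases)
    case Nil
    \<comment> \<open>For empty \<open>v'\<close>, \<open>psi_ok\<close> leaves only the label
      \<open>(1, Circ)\<close>.\<close>
    then show ?thesis using ws v'(2) x by (cases a) (auto simp: blue_label_def)
  next
    case (snoc zs y)
    define p where "p = odots zs"
    have zs: "\<forall>z \<in> set zs. packed z" using ws snoc by (auto simp: irred_def)
    have y: "irred y" "packed y" "y \<noteq> []" using ws snoc by (auto simp: irred_def)
    have p: "packed p" unfolding p_def using zs by (rule packed_odots)
    have v'_eq: "v' = p \<odot> y"
      using odots_append_packed[of zs "[y]"] zs y ws(2) snoc p_def by simp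
    then have split: "v' \<odot> u = p \<odot> (y \<odot> u)" using odot_assoc y v(1) by simp
    have i_le: "i \<le> wmax y"
    proof (rule ccontr)
      assume "\<not> ?thesis"
      \<comment> \<open>Otherwise \<open>y\<close> could pass from \<open>v'\<close> to the left
        part, making it longer.\<close>
      then have "is_blue_pair w (y \<odot> u) (psi (i + wmax u - wmax (y \<odot> u), a) p)"
        using dw is_blue_pair_psi_iff[of "v' \<odot> u" "i + wmax u" a] split p y(2) v(1)
        by (auto simp: is_psi_decomp_def packed_odot wmax_odot)
      then have "length (y \<odot> u) \<le> length u" using bf by (auto simp: is_blue_fact_def)
      then show False using y(3) by simp
    qed
    have no_gd: "\<not> global_descent (psi (i + wmax u, a) (v' \<odot> u)) c" for c
      using assms(1) dw by (auto simp: irred_def is_psi_decomp_def)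
    have "p = []"
    proof (rule ccontr)
      assume "p \<noteq> []"
      then have "global_descent (psi (i + wmax u, a) (p \<odot> (y \<odot> u))) (length p)"
        using p i_le y(2) v(1) by (intro global_descent_psi) (auto simp: wmax_odot)
      then show False using no_gd split by simp
    qed
    then have "v' = y" using v'_eq by simp
    moreover have "(i, a) \<noteq> (1, Circ)"
      \<comment> \<open>The label \<open>(1, Circ)\<close> would append \<open>wmax u + 1\<close>
        and create a descent right after \<open>y\<close>.\<close>
      using no_gd global_descent_psi[OF y(2,3), of "1 + wmax u" u Circ] \<open>v' = y\<close> by auto
    ultimately show ?thesis using y(1) i i_le x by (simp add: blue_label_def)
  qed
qed

text \<open>Irreducibility splits by whether \<open>v'\<close> is empty. For maximality, a rival
  pair gives \<open>v' \<odot> u = z \<odot> u'\<close>, so it suffices that \<open>z\<close> is at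
  least as long as \<open>v'\<close>.\<close>

lemma blue_prod_irred:
  assumes "packed u" "blue_label x v'"
  shows "irred (u \<lhd>\<^sub>B psi x v')" "blue_fact (u \<lhd>\<^sub>B psi x v') = (u, psi x v')"
    "psi_decomp (psi x v') = (x, v')"
proof -
  obtain i a where x: "x = (i, a)" by (cases x)
  have v': "packed v'" "psi_ok (i, a) v'" using blue_label_psi_ok[OF assms(2)] x by auto
  let ?w = "u \<lhd>\<^sub>B psi x v'"
  have w: "?w = psi (i + wmax u, a) (v' \<odot> u)" using blue_prod_psi[OF v'] x by simp
  show "psi_decomp (psi x v') = (x, v')"
    by (rule psi_decomp_eq) (use v' x in \<open>simp add: is_psi_decomp_def\<close>)
  show irr: "irred ?w"
  proof (cases "v' = []")
    case True
    then show ?thesis unfolding w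
      using irred_psi_Circ_max[OF assms(1)] assms(2) x by (auto simp: blue_label_def irred_def)
  next
    case False
    then show ?thesis unfolding w
      using assms x by (intro irred_psi_odot) (auto simp: blue_label_def)
  qed
  have "is_blue_pair ?w u (psi x v')"
    using assms(1) wmax_psi(2)[OF v'] x by (simp add: is_blue_pair_def)
  moreover have "length u' \<le> length u" if bp: "is_blue_pair ?w u' v2" for u' v2
  proof -
    have "psi_ok (i + wmax u, a) (v' \<odot> u)"
      using v' assms(1) by (cases a) (auto simp: wmax_odot)
    then obtain z where z: "packed u'" "packed z" "v' \<odot> u = z \<odot> u'" "wmax u' < i + wmax u"
      using bp is_blue_pair_psi_iff[OF packed_odot[OF v'(1) assms(1)]] unfolding w by blast
    have len: "length v' + length u = length z + length u'"
      using arg_cong[OF z(3), of length] by simp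
    show ?thesis
    proof (cases "v' = []")
      case True
      then show ?thesis using len by simp
    next
      case False
      then have irr': "irred v'" "i \<le> wmax v'" using assms(2) x by (auto simp: blue_label_def)
      obtain zs where zs: "\<forall>y \<in> set zs. irred y" "z = odots zs"
        using irred_decomp_exists[OF z(2)] by (auto simp: is_irred_decomp_def)
      show ?thesis
      proof (cases zs)
        case Nil
        \<comment> \<open>With \<open>z\<close> empty, \<open>u'\<close> would be all of
          \<open>v' \<odot> u\<close>, whose maximum violates the bound on
          \<open>wmax u'\<close>.\<close>
        then have "wmax u' = wmax v' + wmax u"
          using z(3) zs wmax_odot[OF v'(1) assms(1)] by simp
        then show ?thesis using z(4) irr'(2) by simp
      next
        case (Cons y ys)
        have "packed (odots ys)"
          using zs Cons by (intro packed_odots) (auto simp: irred_def)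
        then have "y \<odot> (odots ys \<odot> u') = v' \<odot> u"
          using z zs(2) Cons odot_assoc by simp
        \<comment> \<open>The irreducible \<open>v'\<close> cannot reach beyond the first factor
          \<open>y\<close> of \<open>z\<close>: the end of \<open>y\<close> would be a global
          descent of \<open>v'\<close>.\<close>
        then have "length v' \<le> length y"
          using irred_first_le irr'(1) zs(1) Cons by simp
        then show ?thesis using len zs(2) Cons by simp
      qed
    qed
  qed
  ultimately have "is_blue_fact ?w u (psi x v')" by (simp add: is_blue_fact_def)
  moreover have "packed ?w" "?w \<noteq> []" using irr by (auto simp: irred_def)
  ultimately show "blue_fact ?w = (u, psi x v')"
    using blue_fact_ex1 unfolding blue_fact_def by (intro the1_equality) auto
qed

section \<open>Decompositions, lengths and maxima of products of irreducible words\<close>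

lemma irred_decomp_odots:
  "(\<forall>z \<in> set ws. irred z) \<Longrightarrow> irred_decomp (odots ws) = ws"
  unfolding irred_decomp_def
  by (rule the_equality) (auto simp: is_irred_decomp_def intro: irred_decomp_unique)

lemma irred_decomp_irred: "irred w \<Longrightarrow> irred_decomp w = [w]"
  using irred_decomp_odots[of "[w]"] by simp

lemma length_odots_eq: "length (odots ws) = (\<Sum>z\<leftarrow>ws. length z)"
  by (induction ws) auto

lemma wmax_odots: "(\<forall>z \<in> set ws. packed z) \<Longrightarrow> wmax (odots ws) = (\<Sum>z\<leftarrow>ws. wmax z)"
  by (induction ws) (auto simp: wmax_odot packed_odots)

lemma FB_Nil: "FB [] = []"
  using irred_decomp_odots[of "[]"] by (simp add: FB.simps)

lemma FB_irred: "irred w \<Longrightarrow> FB w = [TB w]"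
  by (simp add: FB.simps irred_decomp_irred) (simp add: irred_def)

section \<open>Round trips between words and trees\<close>

text \<open>The equality of \<open>omega\<close> and \<open>wmax\<close> is part of the induction
  because root labels are bounded by \<open>omega\<close> for trees but by \<open>wmax\<close> for
  words.\<close>

lemma FB_TB_correct:
  "packed w \<longrightarrow> (\<forall>t \<in> set (FB w). blue_packed t) \<and> fsize (FB w) = length w \<and>
     (\<Sum>t\<leftarrow>FB w. omega t) = wmax w \<and> FB_star (FB w) = w"
  "irred z \<longrightarrow> blue_packed (TB z) \<and> tsize (TB z) = length z \<and>
     omega (TB z) = wmax z \<and> TB_star (TB z) = z"
proof (induction w and z rule: FB_TB.induct)
  case (1 w)
  show ?case
  proof
    assume w: "packed w"
    define ws where "ws = irred_decomp w"
    have ws: "\<forall>z \<in> set ws. irred z" "w = odots ws"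
      using irred_decomp[OF w] by (auto simp: is_irred_decomp_def ws_def)
    have FB: "FB w = map TB (rev ws)" using w by (simp add: FB.simps ws_def)
    have IH: "blue_packed (TB z) \<and> tsize (TB z) = length z \<and>
        omega (TB z) = wmax z \<and> TB_star (TB z) = z" if "z \<in> set ws" for z
      using "1.IH"[OF w] that ws(1) by (simp add: ws_def)
    have "map tsize (FB w) = rev (map length ws)" "map omega (FB w) = rev (map wmax ws)"
      using IH by (auto simp: FB rev_map)
    then have "fsize (FB w) = length w" "(\<Sum>t\<leftarrow>FB w. omega t) = wmax w"
      using ws(1) length_odots_eq[of ws] wmax_odots[of ws]
      by (simp_all add: fsize_def irred_def sum_list_rev flip: ws(2))
    moreover have "FB_star (FB w) = w"
      using IH by (simp add: FB FB_star.simps rev_map map_idI flip: ws(2))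
    ultimately show "(\<forall>t \<in> set (FB w). blue_packed t) \<and> fsize (FB w) = length w \<and>
        (\<Sum>t\<leftarrow>FB w. omega t) = wmax w \<and> FB_star (FB w) = w"
      using IH by (auto simp: FB)
  qed
next
  case (2 w)
  show ?case
  proof
    assume w: "irred w"
    obtain u v where b: "blue_fact w = (u, v)" by (cases "blue_fact w")
    obtain i a v' where d: "psi_decomp v = ((i, a), v')" by (metis surj_pair)
    note l = blue_fact_label[OF w b d]
    have v': "packed v'" "psi_ok (i, a) v'" using blue_label_psi_ok[OF l(2)] by auto
    have TB: "TB w = Node (i, a) (FB u) (FB v')" using w b d by (simp add: TB.simps)
    have IHu: "\<forall>t \<in> set (FB u). blue_packed t" "fsize (FB u) = length u"
        "(\<Sum>t\<leftarrow>FB u. omega t) = wmax u" "FB_star (FB u) = u"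
      using "2.IH"(1)[OF w b[symmetric] d[symmetric]] l(1) by simp_all
    have IHv: "\<forall>t \<in> set (FB v'). blue_packed t" "fsize (FB v') = length v'"
        "(\<Sum>t\<leftarrow>FB v'. omega t) = wmax v'" "FB_star (FB v') = v'"
      using "2.IH"(2)[OF w b[symmetric] d[symmetric]] v'(1) by simp_all
    \<comment> \<open>\<open>FB v'\<close> is \<open>[]\<close> or \<open>[TB v']\<close>; in the
      second case \<open>IHv\<close> turns the bound \<open>wmax v'\<close> into
      \<open>omega (TB v')\<close>.\<close>
    have "blue_packed (TB w)"
      using l(2) IHu(1) IHv by (auto simp: TB blue_label_def FB_Nil FB_irred)
    moreover have "tsize (TB w) = length w"
      unfolding TB using IHu(2) IHv(2) l(3) v' by (simp add: fsize_def blue_prod_psi)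
    moreover have "omega (TB w) = wmax w"
      unfolding TB using IHu(3) IHv(3) l(1,3) v' by (simp add: wmax_blue_prod_psi)
    moreover have "TB_star (TB w) = w"
      unfolding TB using IHu(4) IHv(4) l(3) by simp
    ultimately show "blue_packed (TB w) \<and> tsize (TB w) = length w \<and>
        omega (TB w) = wmax w \<and> TB_star (TB w) = w" by blast
  qed
qed

text \<open>The last conjunct for forests supplies the tree step, whose induction hypotheses concern
  forests only, with the irreducibility of the word of the right child.\<close>

lemma FB_star_TB_star_correct:
  "(\<forall>t \<in> set f. blue_packed t) \<longrightarrow> packed (FB_star f) \<and> FB (FB_star f) = f \<and>
     (\<forall>t \<in> set f. irred (TB_star t))"
  "blue_packed t \<longrightarrow> irred (TB_star t) \<and> TB (TB_star t) = t"
proof (induction f and t rule: FB_star_TB_star.induct)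
  case (1 f)
  show ?case
  proof
    assume f: "\<forall>t \<in> set f. blue_packed t"
    then have IH: "irred (TB_star t) \<and> TB (TB_star t) = t" if "t \<in> set f" for t
      using 1 that by auto
    have FB_star: "FB_star f = odots (map TB_star (rev f))" by (simp add: FB_star.simps)
    have "irred_decomp (FB_star f) = map TB_star (rev f)"
      unfolding FB_star using IH by (intro irred_decomp_odots) auto
    moreover have p: "packed (FB_star f)"
      unfolding FB_star using IH by (intro packed_odots) (auto simp: irred_def)
    ultimately have "FB (FB_star f) = f"
      using IH by (simp add: FB.simps rev_map map_idI)
    then show "packed (FB_star f) \<and> FB (FB_star f) = f \<and> (\<forall>t \<in> set f. irred (TB_star t))"
      using p IH by blast
  qed
next
  case (2 x fl fr)
  show ?case
  proof
    assume t: "blue_packed (Node x fl fr)"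
    obtain i a where x: "x = (i, a)" by (cases x)
    have l: "packed (FB_star fl)" "FB (FB_star fl) = fl"
      and r: "packed (FB_star fr)" "FB (FB_star fr) = fr" "\<forall>t \<in> set fr. irred (TB_star t)"
      using 2 t x by auto
    \<comment> \<open>A further induction is avoided: \<open>fr\<close> is \<open>FB\<close> of the
      packed word \<open>FB_star fr\<close>, so the result for words applies.\<close>
    have "(\<Sum>t\<leftarrow>fr. omega t) = wmax (FB_star fr)" using FB_TB_correct(1) r by metis
    then have "blue_label x (FB_star fr)"
      using t x r(3) by (auto simp: blue_label_def FB_star.simps)
    note b = blue_prod_irred[OF l(1) this]
    then show "irred (TB_star (Node x fl fr)) \<and> TB (TB_star (Node x fl fr)) = Node x fl fr"
      using l(2) r(2) by (simp add: TB.simps)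
  qed
qed

theorem mainTheorem6:
  fixes n :: nat
  shows "bij_betw FB (PW n) (blue_forests n) \<and>
         bij_betw TB {w. irred w \<and> length w = n} (blue_trees n) \<and>
         (\<forall>w \<in> PW n. FB_star (FB w) = w) \<and>
         (\<forall>f \<in> blue_forests n. FB (FB_star f) = f) \<and>
         (\<forall>w. irred w \<and> length w = n \<longrightarrow> TB_star (TB w) = w) \<and>
         (\<forall>t \<in> blue_trees n. TB (TB_star t) = t)"
proof -
  have FB: "FB w \<in> blue_forests n \<and> FB_star (FB w) = w" if "w \<in> PW n" for w
    using FB_TB_correct(1)[of w] that by (auto simp: PW_def blue_forests_def)
  \<comment> \<open>The length of \<open>FB_star f\<close> is the size of its image under
    \<open>FB\<close>, which is \<open>f\<close>.\<close>
  have FB': "FB_star f \<in> PW n \<and> FB (FB_star f) = f" if "f \<in> blue_forests n" for f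
    using FB_star_TB_star_correct(1)[of f] FB_TB_correct(1)[of "FB_star f"] that
    by (auto simp: PW_def blue_forests_def)
  have TB: "TB w \<in> blue_trees n \<and> TB_star (TB w) = w" if "irred w \<and> length w = n" for w
    using FB_TB_correct(2)[of w] that by (auto simp: blue_trees_def)
  have TB': "(irred (TB_star t) \<and> length (TB_star t) = n) \<and> TB (TB_star t) = t"
    if "t \<in> blue_trees n" for t
    using FB_star_TB_star_correct(2)[of t] FB_TB_correct(2)[of "TB_star t"] that
    by (auto simp: blue_trees_def)
  have "bij_betw FB (PW n) (blue_forests n)"
    by (rule bij_betw_byWitness[where f' = FB_star]) (use FB FB' in auto)
  moreover have "bij_betw TB {w. irred w \<and> length w = n} (blue_trees n)"
    by (rule bij_betw_byWitness[where f' = TB_star]) (use TB TB' in auto)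
  ultimately show ?thesis using FB FB' TB TB' by blast
qed

end
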